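(* Let $S$ be a subring of a finite ring $R$ and let $r \in K(S,R)$. Then $$\mathrm{Pr}_r(S,R) = \frac{1}{|S||R|}\sum_{\substack{x\in S\\ r\in [x,R]}}|C_R(x)| = \frac{1}{|S|}\sum_{\substack{x\in S\\ r\in [x,R]}}\frac{1}{|[x,R]|}.$$
   Context: For elements $x,y$ of a ring $R$, $[x,y]=xy-yx$. For a subring $S$ of a finite ring $R$ and $r\in R$, $$\mathrm{Pr}_r(S,R)=\frac{|\{(x,y)\in S\times R : [x,y]=r\}|}{|S||R|}.$$ $K(S,R)=\{[x,y] : x\in S,\ y\in R\}$. For $x\in S$, $[x,R]=\{[x,y] : y\in R\}$ (an additive subgroup of $R$), and $C_R(x)=\{y\in R : xy=yx\}$. *)

theory Defs
  imports Complex_Main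
begin

text \<open>Rings are associative but not assumed to be unital or commutative: this is the type
  class \<open>ring\<close>. A ring \<open>R\<close> is given by its underlying set inside a type of this class (the
  whole type being the special case \<open>R = UNIV\<close>), so that \<open>S\<close> and \<open>R\<close> are objects of the
  same kind.\<close>

definition is_subring :: "'a::ring set \<Rightarrow> bool" where
  "is_subring S \<longleftrightarrow> 0 \<in> S \<and> (\<forall>x\<in>S. \<forall>y\<in>S. x - y \<in> S \<and> x * y \<in> S)"

definition commutator :: "'a::ring \<Rightarrow> 'a \<Rightarrow> 'a" where
  "commutator x y = x * y - y * x"

definition commutator_set :: "'a::ring set \<Rightarrow> 'a set \<Rightarrow> 'a set" where
  "commutator_set S R = {commutator x y | x y. x \<in> S \<and> y \<in> R}"

definition commutator_image :: "'a::ring \<Rightarrow> 'a set \<Rightarrow> 'a set" where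
  "commutator_image x R = {commutator x y | y. y \<in> R}"

definition centralizer :: "'a::ring set \<Rightarrow> 'a \<Rightarrow> 'a set" where
  "centralizer R x = {y \<in> R. x * y = y * x}"

definition commuting_prob :: "'a::ring \<Rightarrow> 'a set \<Rightarrow> 'a set \<Rightarrow> real" where
  "commuting_prob r S R =
     real (card {(x, y) \<in> S \<times> R. commutator x y = r}) / (real (card S) * real (card R))"

end

theory Submission imports Defs begin

text \<open>For fixed \<open>x\<close> the map \<open>y \<mapsto> [x, y]\<close> is an additive homomorphism on \<open>R\<close> with kernel
  \<open>C\<^sub>R(x)\<close> and image \<open>[x, R]\<close>. Each nonempty fibre is therefore a translate of the kernel
  (\<open>card_commutator_fibre\<close>). Slicing the pairs \<open>(x, y)\<close> with \<open>[x, y] = r\<close> by their first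
  component gives the first formula, because the slice at \<open>x\<close> is such a fibre if
  \<open>r \<in> [x, R]\<close> and is empty otherwise. The fibres also partition \<open>R\<close>, so that
  \<open>|R| = |[x, R]| |C\<^sub>R(x)|\<close> (\<open>card_image_times_card_centralizer\<close>); dividing by
  \<open>|R|\<close> termwise turns the first sum into the second.\<close>

lemma is_subring_add:
  assumes "is_subring R" "x \<in> R" "y \<in> R"
  shows "x + y \<in> R"
proof -
  have "0 - y \<in> R"
    using assms unfolding is_subring_def by blast
  then have "x - (0 - y) \<in> R"
    using assms unfolding is_subring_def by blast
  then show ?thesis
    by simp
qed

lemma is_subring_diff:
  "is_subring R \<Longrightarrow> x \<in> R \<Longrightarrow> y \<in> R \<Longrightarrow> x - y \<in> R"
  by (simp add: is_subring_def)

lemma commutator_add_right: "commutator x (y + z) = commutator x y + commutator x z"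
  by (simp add: commutator_def algebra_simps)

lemma commutator_diff_right: "commutator x (y - z) = commutator x y - commutator x z"
  by (simp add: commutator_def algebra_simps)

lemma centralizer_eq: "centralizer R x = {y \<in> R. commutator x y = 0}"
  by (simp add: centralizer_def commutator_def)

lemma commutator_image_eq: "commutator_image x R = commutator x ` R"
  by (auto simp: commutator_image_def)

text \<open>If \<open>[x, y\<^sub>0] = r\<close>, then \<open>[x, y] = r\<close> holds exactly when \<open>y - y\<^sub>0\<close> centralizes \<open>x\<close>,
  so the fibre over \<open>r\<close> is the coset \<open>y\<^sub>0 + C\<^sub>R(x)\<close>.\<close>

lemma card_commutator_fibre:
  assumes R: "is_subring R" and r: "r \<in> commutator_image x R"
  shows "card {y \<in> R. commutator x y = r} = card (centralizer R x)"
proof -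
  obtain y0 where y0: "y0 \<in> R" "commutator x y0 = r"
    using r by (auto simp: commutator_image_eq)
  have "bij_betw (\<lambda>y. y - y0) {y \<in> R. commutator x y = r} (centralizer R x)"
    by (rule bij_betw_byWitness[where f' = "\<lambda>z. z + y0"])
       (use R y0 in \<open>auto simp: centralizer_eq commutator_add_right commutator_diff_right
          is_subring_add is_subring_diff\<close>)
  then show ?thesis
    by (rule bij_betw_same_card)
qed

text \<open>The first isomorphism theorem for \<open>y \<mapsto> [x, y]\<close>, at the level of cardinalities.\<close>

lemma card_image_times_card_centralizer:
  assumes R: "is_subring R" and fin: "finite R"
  shows "card R = card (commutator_image x R) * card (centralizer R x)"
proof -
  have "card R = (\<Sum>s\<in>commutator x ` R. card {y \<in> R. commutator x y = s})"
    using sum.image_gen[OF fin, of "\<lambda>_. 1 :: nat" "commutator x"] by simp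
  also have "\<dots> = (\<Sum>s\<in>commutator x ` R. card (centralizer R x))"
    by (intro sum.cong refl card_commutator_fibre R) (simp add: commutator_image_eq)
  finally show ?thesis
    by (simp add: commutator_image_eq)
qed

lemma card_commutator_pairs:
  assumes R: "is_subring R" and finR: "finite R" and finS: "finite S"
  shows "card {(x, y) \<in> S \<times> R. commutator x y = r} =
           (\<Sum>x | x \<in> S \<and> r \<in> commutator_image x R. card (centralizer R x))"
proof -
  let ?T = "{x. x \<in> S \<and> r \<in> commutator_image x R}"
  have "{(x, y) \<in> S \<times> R. commutator x y = r} = (SIGMA x:?T. {y \<in> R. commutator x y = r})"
    by (auto simp: commutator_image_eq)
  then have "card {(x, y) \<in> S \<times> R. commutator x y = r} =
      (\<Sum>x\<in>?T. card {y \<in> R. commutator x y = r})"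
    using finR finS by (simp add: card_SigmaI)
  also have "\<dots> = (\<Sum>x\<in>?T. card (centralizer R x))"
    by (intro sum.cong refl card_commutator_fibre R) simp
  finally show ?thesis .
qed

theorem theorem2p3:
  fixes R S :: "'a::ring set" and r :: 'a
  assumes "is_subring R" and "finite R"
    and "is_subring S" and "S \<subseteq> R"
    and "r \<in> commutator_set S R"
  shows "commuting_prob r S R =
           1 / (real (card S) * real (card R)) *
             (\<Sum>x | x \<in> S \<and> r \<in> commutator_image x R. real (card (centralizer R x)))
       \<and> 1 / (real (card S) * real (card R)) *
             (\<Sum>x | x \<in> S \<and> r \<in> commutator_image x R. real (card (centralizer R x))) =
         1 / real (card S) *
             (\<Sum>x | x \<in> S \<and> r \<in> commutator_image x R. 1 / real (card (commutator_image x R)))"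
proof
  have finS: "finite S"
    using assms by (simp add: finite_subset)
  show "commuting_prob r S R =
           1 / (real (card S) * real (card R)) *
             (\<Sum>x | x \<in> S \<and> r \<in> commutator_image x R. real (card (centralizer R x)))"
    unfolding commuting_prob_def card_commutator_pairs[OF assms(1,2) finS] by simp
next
  have "card R > 0"
    using assms(1,2) by (auto simp: card_gt_0_iff is_subring_def)
  then have quotient: "real (card (centralizer R x)) / real (card R) =
      1 / real (card (commutator_image x R))" for x
    using card_image_times_card_centralizer[OF assms(1,2), of x] by (simp add: field_simps)
  show "1 / (real (card S) * real (card R)) *
             (\<Sum>x | x \<in> S \<and> r \<in> commutator_image x R. real (card (centralizer R x))) =
         1 / real (card S) *
             (\<Sum>x | x \<in> S \<and> r \<in> commutator_image x R. 1 / real (card (commutator_image x R)))"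
    unfolding quotient[symmetric] by (simp add: sum_divide_distrib[symmetric])
qed

end
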